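(* Let $G$ and $H$ be finite connected graphs, each with at least two vertices. Then $\mathrm{rc}(G\circ H)=\mathrm{rc}(G)$ if $\mathrm{rc}(G)\ge 1$, and $\mathrm{rc}(G\circ H)=\min\{1,\mathrm{rc}(H)\}$ if $\mathrm{rc}(G)=0$.
   Context: The lexicographic product $G\circ H$ has vertex set $V(G)\times V(H)$, with $(g_1,h_1)$ adjacent to $(g_2,h_2)$ iff $g_1g_2\in E(G)$, or ($g_1=g_2$ and $h_1h_2\in E(H)$). Cop and robber game with radius of capture $k$: first the cop chooses a vertex, then the robber; afterwards, starting with the cop, the players alternately either move to an adjacent vertex or stay put, both knowing both positions. The cop wins if at some point the distance between the players is at most $k$. $\mathcal{CWRC}(k)$ is the class of graphs on which the cop has a winning strategy. $\mathrm{rc}(G)=\min\{k\in\mathbb{N}_0 \mid G\in\mathcal{CWRC}(k)\}$. *)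

theory Defs
  imports "Graph_Theory.Graph_Theory"
begin

text \<open>
  Graphs are simple undirected graphs in the sense of \<^locale>\<open>pair_bidirected_digraph\<close>
  (symmetric, loop-free arc relation); the finite ones are exactly those satisfying
  \<^locale>\<open>pair_graph\<close>. Connectedness is \<^const>\<open>connected\<close>, which requires a
  nonempty vertex set.
\<close>

definition lexicographic_product ::
    "'a pair_pre_digraph \<Rightarrow> 'b pair_pre_digraph \<Rightarrow> ('a \<times> 'b) pair_pre_digraph" where
  "lexicographic_product G H =
    \<lparr> pverts = pverts G \<times> pverts H,
      parcs = {((g1, h1), (g2, h2)) | g1 h1 g2 h2.
        g1 \<in> pverts G \<and> g2 \<in> pverts G \<and> h1 \<in> pverts H \<and> h2 \<in> pverts H \<and>
        ((g1, g2) \<in> parcs G \<or> g1 = g2 \<and> (h1, h2) \<in> parcs H)} \<rparr>"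

text \<open>
  The usual graph distance: all arcs have weight 1, and the value is infinite if there is no walk.
\<close>
definition graph_dist :: "'a pair_pre_digraph \<Rightarrow> 'a \<Rightarrow> 'a \<Rightarrow> ereal" where
  "graph_dist G u v = wf_digraph.\<mu> (with_proj G) (\<lambda>_. 1) u v"

definition legal_move :: "'a pair_pre_digraph \<Rightarrow> 'a \<Rightarrow> 'a \<Rightarrow> bool" where
  "legal_move G u v \<longleftrightarrow> u \<in> pverts G \<and> v \<in> pverts G \<and> (u = v \<or> (u, v) \<in> parcs G)"

text \<open>
  A play is \<open>c 0, r 0, c 1, r 1, \<dots>\<close>, where \<open>c\<close> and \<open>r\<close> are the
  positions of the cop and the robber. Plays are continued forever; what happens after
  the robber has been captured is irrelevant, and both players can always stay put.
\<close>
definition robber_play :: "'a pair_pre_digraph \<Rightarrow> (nat \<Rightarrow> 'a) \<Rightarrow> bool" where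
  "robber_play G r \<longleftrightarrow> r 0 \<in> pverts G \<and> (\<forall>n. legal_move G (r n) (r (Suc n)))"

text \<open>
  A cop strategy maps the list \<open>[r 0, \<dots>, r (n - 1)]\<close> of robber positions seen so far to
  the position \<open>c n\<close>; in particular, its value on the empty list is the initial vertex.
  The cop's own earlier positions are determined by the strategy on the prefixes of that list,
  so they need not be passed as a further argument.
\<close>
definition cop_play :: "('a list \<Rightarrow> 'a) \<Rightarrow> (nat \<Rightarrow> 'a) \<Rightarrow> nat \<Rightarrow> 'a" where
  "cop_play \<sigma> r n = \<sigma> (map r [0..<n])"

definition cop_strategy :: "'a pair_pre_digraph \<Rightarrow> ('a list \<Rightarrow> 'a) \<Rightarrow> bool" where
  "cop_strategy G \<sigma> \<longleftrightarrow> \<sigma> [] \<in> pverts G \<and>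
    (\<forall>r. robber_play G r \<longrightarrow> (\<forall>n. legal_move G (cop_play \<sigma> r n) (cop_play \<sigma> r (Suc n))))"

text \<open>
  The two disjuncts are the positions after a robber's turn (or placement) and
  after a cop's turn.
\<close>
definition cop_wins_play ::
    "'a pair_pre_digraph \<Rightarrow> nat \<Rightarrow> (nat \<Rightarrow> 'a) \<Rightarrow> (nat \<Rightarrow> 'a) \<Rightarrow> bool" where
  "cop_wins_play G k c r \<longleftrightarrow>
    (\<exists>n. graph_dist G (c n) (r n) \<le> ereal (real k) \<or>
         graph_dist G (c (Suc n)) (r n) \<le> ereal (real k))"

definition CWRC :: "nat \<Rightarrow> 'a pair_pre_digraph set" where
  "CWRC k = {G. pair_bidirected_digraph G \<and>
    (\<exists>\<sigma>. cop_strategy G \<sigma> \<and> (\<forall>r. robber_play G r \<longrightarrow> cop_wins_play G k (cop_play \<sigma> r) r))}"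

definition rc :: "'a pair_pre_digraph \<Rightarrow> nat" where
  "rc G = (LEAST k. G \<in> CWRC k)"

end

theory Submission
  imports Defs
begin

text \<open>
  The game on a finite graph is determined: the cop fails to win with radius \<open>k\<close> iff there is
  an evasive set, a set of positions (cop to move) that meets every initial vertex of the cop and
  to which the robber can always return without being captured in between. So it suffices to
  transport evasive sets between \<open>G\<close>, \<open>H\<close> and \<open>G \<circ> H\<close>. For \<open>k \<ge> 1\<close> an evasive set of
  \<open>G \<circ> H\<close> never contains a position with both players in the same fibre, as the cop could step
  to a neighbouring fibre; and outside a common fibre the distances in \<open>G \<circ> H\<close> are those in
  \<open>G\<close>. Hence only \<open>k = 0\<close> involves \<open>H\<close>.
\<close>

section \<open>Legal moves and graph distance\<close>

lemma legal_move_refl: "u \<in> pverts G \<Longrightarrow> legal_move G u u"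
  by (simp add: legal_move_def)

lemma legal_move_verts:
  "legal_move G u v \<Longrightarrow> u \<in> pverts G" "legal_move G u v \<Longrightarrow> v \<in> pverts G"
  by (simp_all add: legal_move_def)

text \<open>Staying put pads shorter walks to exactly \<open>k\<close> moves, so the weighted
  infimum can be traded for a power of \<open>legal_move\<close>. Membership of \<open>u\<close>
  matters at \<open>k = 0\<close>, where the power is equality on the whole type.\<close>

lemma graph_dist_le_iff:
  assumes "pair_graph G" and u: "u \<in> pverts G"
  shows "graph_dist G u v \<le> ereal (real k) \<longleftrightarrow> (legal_move G ^^ k) u v"
proof -
  interpret pair_graph G by fact
  have "graph_dist G u v \<le> ereal (real k) \<longleftrightarrow> (\<exists>p. awalk u p v \<and> length p \<le> k)"
  proof
    have cost: "awalk_cost (\<lambda>_. 1) p = real (length p)" for p :: "('a \<times> 'a) list"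
      by (induction p) auto
    show "\<exists>p. awalk u p v \<and> length p \<le> k" if le: "graph_dist G u v \<le> ereal (real k)"
    proof (rule ccontr)
      assume "\<nexists>p. awalk u p v \<and> length p \<le> k"
      \<comment> \<open>Walk lengths are integers, so every cost is at least \<open>k + 1\<close>;
        this also covers the empty infimum.\<close>
      then have "ereal (real (Suc k)) \<le> graph_dist G u v"
        unfolding graph_dist_def \<mu>_def cost by (intro INF_greatest) (auto simp: not_le)
      then have "ereal (real (Suc k)) \<le> ereal (real k)"
        using le by (rule order_trans)
      then show False by simp
    qed
    show "graph_dist G u v \<le> ereal (real k)" if "\<exists>p. awalk u p v \<and> length p \<le> k"
      using that min_cost_le_walk_cost[of u _ v "\<lambda>_. 1"]
      unfolding graph_dist_def cost by (meson ereal_less_eq(3) of_nat_mono order_trans)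
  qed
  also have "\<dots> \<longleftrightarrow> (legal_move G ^^ k) u v"
    using u
  proof (induction k arbitrary: u)
    case 0
    then show ?case by (auto simp: awalk_Nil_iff)
  next
    case (Suc k)
    have "(\<exists>p. awalk u p v \<and> length p \<le> Suc k) \<longleftrightarrow>
        (\<exists>w. legal_move G u w \<and> (\<exists>p. awalk w p v \<and> length p \<le> k))"
    proof safe
      fix p assume p: "awalk u p v" "length p \<le> Suc k"
      show "\<exists>w. legal_move G u w \<and> (\<exists>p. awalk w p v \<and> length p \<le> k)"
      proof (cases p)
        case Nil
        then show ?thesis using p Suc.prems by (intro exI[of _ u]) (auto simp: legal_move_def)
      next
        case (Cons e es)
        then show ?thesis using p
          by (intro exI[of _ "snd e"])
             (auto simp: legal_move_def awalk_Cons_iff arc_snd_in_verts arc_fst_in_verts)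
      qed
    next
      fix w p assume w: "legal_move G u w" and p: "awalk w p v" "length p \<le> k"
      show "\<exists>p. awalk u p v \<and> length p \<le> Suc k"
      proof (cases "u = w")
        case True
        then show ?thesis using p le_Suc_eq by blast
      next
        case False
        then show ?thesis using w p
          by (intro exI[of _ "(u, w) # p"]) (auto simp: legal_move_def awalk_Cons_iff)
      qed
    qed
    also have "\<dots> \<longleftrightarrow> (\<exists>w. legal_move G u w \<and> (legal_move G ^^ k) w v)"
      using Suc.IH legal_move_verts(2) by metis
    finally show ?case by (metis relpowp_Suc_I2 relpowp_Suc_E2)
  qed
  finally show ?thesis .
qed

section \<open>Evasive sets and determinacy of the game\<close>

text \<open>
  Since \<open>c' = c\<close> is a legal move, the position \<open>(c, r)\<close> itself is required to be safe.
\<close>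
definition evade :: "'a pair_pre_digraph \<Rightarrow> nat \<Rightarrow> ('a \<times> 'a) set \<Rightarrow> ('a \<times> 'a) set" where
  "evade G k S = {(c, r). c \<in> pverts G \<and> r \<in> pverts G \<and>
    (\<forall>c'. legal_move G c c' \<longrightarrow>
      \<not> (legal_move G ^^ k) c' r \<and> (\<exists>r'. legal_move G r r' \<and> (c', r') \<in> S))}"

definition evasive :: "'a pair_pre_digraph \<Rightarrow> nat \<Rightarrow> ('a \<times> 'a) set \<Rightarrow> bool" where
  "evasive G k S \<longleftrightarrow> S \<subseteq> evade G k S \<and> (\<forall>c \<in> pverts G. \<exists>r. (c, r) \<in> S)"

lemma evade_mono: "S \<subseteq> T \<Longrightarrow> evade G k S \<subseteq> evade G k T"
  unfolding evade_def by blast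

lemma evade_subset: "evade G k S \<subseteq> pverts G \<times> pverts G"
  unfolding evade_def by blast

lemma relpowp_legal_move_stay:
  assumes "(legal_move G ^^ k) u v" "u \<in> pverts G" "k \<le> l"
  shows "(legal_move G ^^ l) u v"
  using assms(3,1)
proof (induction rule: dec_induct)
  case (step n)
  have "v \<in> pverts G"
    using assms(1,2) by (cases k) (auto simp: legal_move_def)
  with step show ?case using legal_move_refl by (metis relpowp_Suc_I)
qed

lemma robber_play_verts: "robber_play G r \<Longrightarrow> r n \<in> pverts G"
  unfolding robber_play_def by (cases n) (auto simp: legal_move_def)

lemma evasive_imp_not_CWRC:
  assumes G: "pair_graph G" and S: "evasive G k S"
  shows "G \<notin> CWRC k"
proof
  assume "G \<in> CWRC k"
  then obtain \<sigma> where \<sigma>: "cop_strategy G \<sigma>"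
    and win: "\<And>r. robber_play G r \<Longrightarrow> cop_wins_play G k (cop_play \<sigma> r) r"
    unfolding CWRC_def by blast
  \<comment> \<open>The default of staying put makes \<open>resp\<close> legal at every vertex. So
    the robber's play is legal before the invariant \<open>inS\<close> is known; this order matters,
    as \<open>cop_strategy\<close> binds the cop only against legal robber plays.\<close>
  define resp where "resp c r = (if \<exists>r'. legal_move G r r' \<and> (c, r') \<in> S
      then SOME r'. legal_move G r r' \<and> (c, r') \<in> S else r)" for c r
  define r0 where "r0 = (SOME r. (\<sigma> [], r) \<in> S)"
  \<comment> \<open>\<open>h n\<close> lists \<open>r 0\<close> to \<open>r n\<close>, so
    \<open>\<sigma> (h n)\<close> is the cop's position \<open>n + 1\<close>, to which
    \<open>r (Suc n)\<close> replies.\<close>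
  define h where "h n = rec_nat [r0] (\<lambda>_ l. l @ [resp (\<sigma> l) (last l)]) n" for n
  have h0: "h 0 = [r0]" and hSuc: "h (Suc n) = h n @ [resp (\<sigma> (h n)) (last (h n))]" for n
    by (simp_all add: h_def)
  define r where "r n = last (h n)" for n
  have hist: "map r [0..<Suc n] = h n" for n
    by (induction n) (simp_all add: r_def h0 hSuc)
  have rSuc: "r (Suc n) = resp (cop_play \<sigma> r (Suc n)) (r n)" for n
    unfolding cop_play_def hist by (simp add: r_def hSuc)
  have c0: "cop_play \<sigma> r 0 \<in> pverts G"
    using \<sigma> by (simp add: cop_play_def cop_strategy_def)
  then have start: "(cop_play \<sigma> r 0, r 0) \<in> S"
    using S unfolding evasive_def by (auto simp: cop_play_def r_def h0 r0_def intro: someI_ex)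
  have SV: "S \<subseteq> pverts G \<times> pverts G"
    using S evade_subset unfolding evasive_def by blast
  have resp: "legal_move G r (resp c r)" if "r \<in> pverts G" for c r
    unfolding resp_def using that someI_ex[of "\<lambda>r'. legal_move G r r' \<and> (c, r') \<in> S"]
    by (auto simp: legal_move_refl)
  have rV: "r n \<in> pverts G" for n
  proof (induction n)
    case 0
    then show ?case using start SV by blast
  next
    case (Suc n)
    then show ?case unfolding rSuc using resp legal_move_verts(2) by metis
  qed
  then have play: "robber_play G r"
    unfolding robber_play_def using resp rSuc by metis
  then have legal: "legal_move G (cop_play \<sigma> r n) (cop_play \<sigma> r (Suc n))" for n
    using \<sigma> unfolding cop_strategy_def by blast
  have inS: "(cop_play \<sigma> r n, r n) \<in> S" for n
  proof (induction n)
    case 0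
    then show ?case by (rule start)
  next
    case (Suc n)
    then have "\<exists>r'. legal_move G (r n) r' \<and> (cop_play \<sigma> r (Suc n), r') \<in> S"
      using S legal unfolding evasive_def evade_def by blast
    then show ?case unfolding rSuc resp_def by (simp, metis (mono_tags, lifting) someI_ex)
  qed
  have far: "\<not> (legal_move G ^^ k) c' (r n)" if "legal_move G (cop_play \<sigma> r n) c'" for c' n
    using inS[of n] S that unfolding evasive_def evade_def by blast
  obtain n where "graph_dist G (cop_play \<sigma> r n) (r n) \<le> ereal (real k) \<or>
      graph_dist G (cop_play \<sigma> r (Suc n)) (r n) \<le> ereal (real k)"
    using win[OF play] unfolding cop_wins_play_def by blast
  \<comment> \<open>Capture after the cop's turn is excluded by the cop's actual move, capture after
    the robber's turn by the move of staying put.\<close>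
  then show False
    using far[OF legal[of n]] far[OF legal_move_refl] legal_move_verts[OF legal[of n]]
    by (auto simp: graph_dist_le_iff[OF G])
qed

text \<open>Backward induction: \<open>A n\<close> holds the positions from which the robber can
  survive \<open>n\<close> more cop turns. By finiteness these sets stabilise at some
  \<open>A N\<close>, which misses an initial vertex; from there the cop captures within
  \<open>N\<close> turns.\<close>

lemma not_evasive_imp_CWRC:
  assumes G: "pair_graph G" and S: "\<And>S. \<not> evasive G k S"
  shows "G \<in> CWRC k"
proof -
  interpret pair_graph G by fact
  define A where "A n = (evade G k ^^ n) (pverts G \<times> pverts G)" for n
  have A0: "A 0 = pverts G \<times> pverts G" and ASuc: "A (Suc n) = evade G k (A n)" for n
    by (simp_all add: A_def)
  have AV: "A n \<subseteq> pverts G \<times> pverts G" for n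
    using evade_subset by (cases n) (auto simp: A0 ASuc)
  have dec: "A (Suc n) \<subseteq> A n" for n
  proof (induction n)
    case 0
    show ?case using AV[of "Suc 0"] by (simp only: A0)
  next
    case (Suc n)
    then show ?case unfolding ASuc[of n] ASuc[of "Suc n"] by (rule evade_mono)
  qed
  obtain N where N: "\<And>n. card (A N) \<le> card (A n)"
    using ex_has_least_nat[of "\<lambda>_. True" 0 "\<lambda>n. card (A n)"] by auto
  have "finite (A N)"
    using AV finite_subset pair_finite_verts by blast
  then have "A (Suc N) = A N"
    using card_seteq dec N by blast
  \<comment> \<open>\<open>A N\<close> is its own image under \<open>evade G k\<close>, so it can
    fail to be evasive only by missing an initial vertex.\<close>
  then obtain c0 where c0: "c0 \<in> pverts G" "\<And>r. (c0, r) \<notin> A N"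
    using S[of "A N"] unfolding evasive_def ASuc by auto
  \<comment> \<open>From a position outside \<open>A (Suc m)\<close> such a move exists: it captures
    or leaves the robber no reply in \<open>A m\<close>.\<close>
  define good where "good m c r c' \<longleftrightarrow> legal_move G c c' \<and> ((legal_move G ^^ k) c' r \<or>
    (\<forall>r'. legal_move G r r' \<longrightarrow> (c', r') \<notin> A m))" for m c r c'
  define mv where "mv m c r = (if \<exists>c'. good m c r c' then SOME c'. good m c r c' else c)" for m c r
  \<comment> \<open>On the reversed list the head is the latest robber position and
    \<open>length l\<close> counts the earlier ones. The index drops by one per move and remains 0
    after \<open>N\<close> moves, where \<open>mv\<close> is still legal.\<close>
  define st where "st = rec_list c0 (\<lambda>r l c. mv (N - Suc (length l)) c r)"
  define \<sigma> where "\<sigma> l = st (rev l)" for l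
  have c_0: "cop_play \<sigma> r 0 = c0"
    and c_Suc: "cop_play \<sigma> r (Suc n) = mv (N - Suc n) (cop_play \<sigma> r n) (r n)" for r n
    by (simp_all add: cop_play_def \<sigma>_def st_def)
  have mv: "legal_move G c (mv m c r)" if "c \<in> pverts G" for m c r
    using that someI_ex[of "good m c r"] by (auto simp: mv_def legal_move_refl good_def)
  have cV: "cop_play \<sigma> r n \<in> pverts G" for r n
    by (induction n) (use c0(1) legal_move_verts(2)[OF mv] in \<open>simp_all add: c_0 c_Suc\<close>)
  have legal: "legal_move G (cop_play \<sigma> r n) (cop_play \<sigma> r (Suc n))" for r n
    unfolding c_Suc by (rule mv[OF cV])
  have \<sigma>: "cop_strategy G \<sigma>"
    unfolding cop_strategy_def using legal cV[of "\<lambda>_. undefined" 0] by (simp add: cop_play_def)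
  have "cop_wins_play G k (cop_play \<sigma> r) r" if r: "robber_play G r" for r
  proof (rule ccontr)
    assume "\<not> ?thesis"
    then have far: "\<not> (legal_move G ^^ k) (cop_play \<sigma> r (Suc n)) (r n)" for n
      unfolding cop_wins_play_def by (auto simp: graph_dist_le_iff[OF G cV])
    \<comment> \<open>At \<open>n = N\<close> this is absurd, since \<open>A 0\<close> contains all
      positions.\<close>
    have "(cop_play \<sigma> r n, r n) \<notin> A (N - n)" if "n \<le> N" for n
      using that
    proof (induction n)
      case 0
      then show ?case by (simp add: c_0 c0)
    next
      case (Suc n)
      define m where "m = N - Suc n"
      have "N - n = Suc m" using Suc.prems by (simp add: m_def)
      then have "(cop_play \<sigma> r n, r n) \<notin> evade G k (A m)"
        using Suc ASuc by simp
      then have "\<exists>c'. good m (cop_play \<sigma> r n) (r n) c'"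
        using cV robber_play_verts[OF r] unfolding evade_def good_def by blast
      then have "good m (cop_play \<sigma> r n) (r n) (cop_play \<sigma> r (Suc n))"
        unfolding c_Suc mv_def m_def by (simp add: someI_ex)
      then show ?case
        using far r unfolding good_def m_def robber_play_def by blast
    qed
    from this[of N] show False
      using cV robber_play_verts[OF r] by (simp add: A0)
  qed
  then show ?thesis
    unfolding CWRC_def using \<sigma> pair_bidirected_digraph_axioms by blast
qed

lemma CWRC_iff_not_evasive:
  "pair_graph G \<Longrightarrow> G \<in> CWRC k \<longleftrightarrow> (\<nexists>S. evasive G k S)"
  using evasive_imp_not_CWRC not_evasive_imp_CWRC by blast

lemma evasiveD:
  assumes "evasive G k S" "(c, r) \<in> S"
  shows "c \<in> pverts G" "r \<in> pverts G"
    and "legal_move G c c' \<Longrightarrow> \<not> (legal_move G ^^ k) c' r"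
    and "legal_move G c c' \<Longrightarrow> \<exists>r'. legal_move G r r' \<and> (c', r') \<in> S"
  using assms unfolding evasive_def evade_def by blast+

lemma evasive_start: "evasive G k S \<Longrightarrow> c \<in> pverts G \<Longrightarrow> \<exists>r. (c, r) \<in> S"
  unfolding evasive_def by blast

lemma evasiveI:
  assumes "\<And>c. c \<in> pverts G \<Longrightarrow> \<exists>r. (c, r) \<in> S"
    and "\<And>c r. (c, r) \<in> S \<Longrightarrow> c \<in> pverts G \<and> r \<in> pverts G"
    and "\<And>c r c'. (c, r) \<in> S \<Longrightarrow> legal_move G c c' \<Longrightarrow> \<not> (legal_move G ^^ k) c' r"
    and "\<And>c r c'. (c, r) \<in> S \<Longrightarrow> legal_move G c c' \<Longrightarrow> \<exists>r'. legal_move G r r' \<and> (c', r') \<in> S"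
  shows "evasive G k S"
  using assms unfolding evasive_def evade_def by blast

text \<open>Padding by stays turns \<open>k\<close> moves into \<open>l\<close>, so an evasive set
  for \<open>l\<close> is one for \<open>k\<close>.\<close>

lemma CWRC_mono:
  assumes "pair_graph G" "G \<in> CWRC k" "k \<le> l"
  shows "G \<in> CWRC l"
proof -
  have "evasive G k S" if S: "evasive G l S" for S
  proof (rule evasiveI)
    show "\<not> (legal_move G ^^ k) c' r" if "(c, r) \<in> S" "legal_move G c c'" for c r c'
      using evasiveD(3)[OF S that] relpowp_legal_move_stay[OF _ legal_move_verts(2)] that assms(3)
      by metis
  qed (use evasiveD[OF S] evasive_start[OF S] in blast)+
  then show ?thesis
    using assms CWRC_iff_not_evasive by blast
qed

section \<open>Consequences of connectedness\<close>

lemma connected_imp_legal_walk: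
  assumes "pair_graph G" "connected (with_proj G)" "u \<in> pverts G" "v \<in> pverts G"
  shows "\<exists>k. (legal_move G ^^ k) u v"
proof -
  interpret pair_graph G by fact
  \<comment> \<open>\<open>connected\<close> refers to the symmetric closure, which for a symmetric
    graph has the same reachability.\<close>
  have "u \<rightarrow>\<^sup>*\<^bsub>with_proj G\<^esub> v"
    using assms(2-4) reachable_mk_symmetric_eq[OF sym_arcs] unfolding connected_def strongly_connected_def
    by simp
  then obtain p where "awalk u p v"
    unfolding reachable_awalk by blast
  then have "graph_dist G u v < \<infinity>"
    unfolding graph_dist_def \<mu>_reach_conv by (rule reachable_awalkI)
  then obtain k where "graph_dist G u v \<le> ereal (real k)"
    by (metis less_PInf_Ex_of_nat less_imp_le less_irrefl)
  then show ?thesis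
    using graph_dist_le_iff[OF assms(1,3)] by blast
qed

text \<open>Ensures that the \<open>LEAST\<close> in \<open>rc\<close> is attained: for a large
  radius every placement of the robber is already a capture.\<close>

lemma connected_imp_CWRC:
  assumes G: "pair_graph G" and con: "connected (with_proj G)"
  shows "\<exists>k. G \<in> CWRC k"
proof -
  interpret pair_graph G by fact
  obtain c where c: "c \<in> pverts G"
    using con unfolding connected_def strongly_connected_def by auto
  \<comment> \<open>Some number of moves to \<open>v\<close>, not necessarily the distance; an upper
    bound suffices.\<close>
  define d where "d v = (SOME k. (legal_move G ^^ k) c v)" for v
  define K where "K = Max (d ` pverts G)"
  have d: "(legal_move G ^^ d v) c v" "d v \<le> K" if "v \<in> pverts G" for v
    using that connected_imp_legal_walk[OF G con c] pair_finite_verts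
    by (auto simp: d_def K_def intro: someI_ex)
  have "\<not> evasive G K S" for S
  proof
    assume S: "evasive G K S"
    then obtain r where "(c, r) \<in> S" using evasive_start[OF S c] by blast
    with S show False
      using evasiveD(2,3)[OF S] legal_move_refl[OF c] relpowp_legal_move_stay[OF d(1) c d(2)]
      by blast
  qed
  then show ?thesis using CWRC_iff_not_evasive[OF G] by blast
qed

lemma rc_eq_0_iff:
  assumes "pair_graph G" "connected (with_proj G)"
  shows "rc G = 0 \<longleftrightarrow> G \<in> CWRC 0"
  unfolding rc_def using connected_imp_CWRC[OF assms] by (metis LeastI Least_eq_0)

text \<open>Supplies the neighbouring fibre to which the cop can step.\<close>

lemma connected_imp_neighbour:
  assumes "pair_graph G" "connected (with_proj G)" "card (pverts G) \<ge> 2" "u \<in> pverts G"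
  shows "\<exists>v. (u, v) \<in> parcs G"
proof -
  obtain v where v: "v \<in> pverts G" "v \<noteq> u"
    using assms(3) card_mono[of "{u}" "pverts G"] by fastforce
  then obtain k where "(legal_move G ^^ k) u v"
    using connected_imp_legal_walk assms by metis
  then have "\<exists>w. legal_move G u w \<and> w \<noteq> u"
    using v(2)
  proof (induction k arbitrary: u)
    case (Suc k)
    then show ?case by (metis relpowp_Suc_E2)
  qed auto
  then show ?thesis by (auto simp: legal_move_def)
qed

section \<open>Moves and walks in the product\<close>

lemma pverts_lexicographic_product [simp]:
  "pverts (lexicographic_product G H) = pverts G \<times> pverts H"
  by (simp add: lexicographic_product_def)

lemma legal_move_lexicographic_product_iff:
  "legal_move (lexicographic_product G H) (g1, h1) (g2, h2) \<longleftrightarrow>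
    g1 \<in> pverts G \<and> g2 \<in> pverts G \<and> h1 \<in> pverts H \<and> h2 \<in> pverts H \<and>
    ((g1, g2) \<in> parcs G \<or> g1 = g2 \<and> (h1 = h2 \<or> (h1, h2) \<in> parcs H))"
  by (auto simp: legal_move_def lexicographic_product_def)

lemma pair_graph_lexicographic_product:
  assumes "pair_graph G" "pair_graph H"
  shows "pair_graph (lexicographic_product G H)"
proof -
  interpret G: pair_graph G by fact
  interpret H: pair_graph H by fact
  let ?P = "lexicographic_product G H"
  have sub: "parcs ?P \<subseteq> pverts ?P \<times> pverts ?P"
    by (auto simp: lexicographic_product_def)
  have fin: "finite (pverts ?P)"
    using G.pair_finite_verts H.pair_finite_verts by simp
  show ?thesis
  proof
    show "finite (parcs ?P)"
      using finite_subset[OF sub] fin by blast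
    show "symmetric (with_proj ?P)"
      using G.arcs_symmetric H.arcs_symmetric
      by (auto simp: symmetric_def lexicographic_product_def intro!: symI)
    show "fst e \<noteq> snd e" if "e \<in> parcs ?P" for e
      using that G.no_loops' H.no_loops' by (auto simp: lexicographic_product_def)
  qed (use sub fin in auto)
qed

lemma legal_walk_lexicographic_product_fst:
  "(legal_move (lexicographic_product G H) ^^ k) (g, h) (g', h') \<Longrightarrow> (legal_move G ^^ k) g g'"
proof (induction k arbitrary: g' h')
  case (Suc k)
  then obtain a b where ab: "(legal_move (lexicographic_product G H) ^^ k) (g, h) (a, b)"
      "legal_move (lexicographic_product G H) (a, b) (g', h')"
    by (metis relpowp_Suc_E surj_pair)
  have "legal_move G a g'"
    using ab(2) by (auto simp: legal_move_lexicographic_product_iff) (auto simp: legal_move_def)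
  then show ?case using Suc.IH[OF ab(1)] by (metis relpowp_Suc_I)
qed auto

text \<open>An arc of \<open>G\<close> permits any change of the second coordinate. As
  \<open>g \<noteq> g'\<close>, the walk enters \<open>g'\<close> along an arc, and
  \<open>h'\<close> can be chosen there.\<close>

lemma legal_walk_lexicographic_productI:
  assumes "(legal_move G ^^ k) g g'" "g \<noteq> g'" "h \<in> pverts H" "h' \<in> pverts H"
  shows "(legal_move (lexicographic_product G H) ^^ k) (g, h) (g', h')"
  using assms(1,2)
proof (induction k arbitrary: g)
  case (Suc k)
  then obtain a where a: "legal_move G g a" "(legal_move G ^^ k) a g'"
    by (metis relpowp_Suc_E2)
  show ?case
  proof (cases "a = g'")
    case True
    \<comment> \<open>On the first arrival at \<open>g'\<close> the second coordinate is set to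
      \<open>h'\<close>; the rest of the walk is replaced by stays.\<close>
    have "legal_move (lexicographic_product G H) (g, h) (g', h')"
      using a(1) True Suc.prems assms(3,4)
      by (auto simp: legal_move_lexicographic_product_iff legal_move_def[of G])
    then have "(legal_move (lexicographic_product G H) ^^ 1) (g, h) (g', h')"
      by (simp only: relpowp_1)
    then show ?thesis
      using relpowp_legal_move_stay[of 1 "lexicographic_product G H" _ _ "Suc k"] a(1) assms(3)
      by (simp add: legal_move_def[of G])
  next
    case False
    have "legal_move (lexicographic_product G H) (g, h) (a, h)"
      using a(1) assms(3) by (auto simp: legal_move_lexicographic_product_iff legal_move_def[of G] legal_move_def[of H])
    then show ?thesis
      using Suc.IH[OF a(2) False] by (metis relpowp_Suc_I2)
  qed
qed auto

lemma legal_move_lexicographic_product_fst: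
  "legal_move (lexicographic_product G H) p q \<Longrightarrow> legal_move G (fst p) (fst q)"
  by (cases p; cases q) (auto simp: legal_move_lexicographic_product_iff legal_move_def[of G] legal_move_def[of H])

section \<open>Transport of evasive sets\<close>

text \<open>The robber plays against the cop's projection to \<open>G\<close> and keeps the second
  coordinate \<open>y\<close>. Projection does not increase distances, so no capture occurs.\<close>

lemma evasive_lexicographic_product_if_evasive:
  assumes S: "evasive G k S" and H: "pverts H \<noteq> {}"
  shows "\<exists>S'. evasive (lexicographic_product G H) k S'"
proof -
  let ?P = "lexicographic_product G H"
  obtain y where y: "y \<in> pverts H" using H by blast
  define S' where "S' = {((g, h), (g', y)) | g h g'. (g, g') \<in> S \<and> h \<in> pverts H}"
  have "evasive ?P k S'"
  proof (rule evasiveI)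
    fix c assume "c \<in> pverts ?P"
    then show "\<exists>r. (c, r) \<in> S'"
      using evasive_start[OF S] by (force simp: S'_def)
  next
    fix c r assume "(c, r) \<in> S'"
    then show "c \<in> pverts ?P \<and> r \<in> pverts ?P"
      using evasiveD(1,2)[OF S] y by (auto simp: S'_def)
  next
    fix c r c' assume "(c, r) \<in> S'" and c': "legal_move ?P c c'"
    then obtain g where cr: "(fst c, g) \<in> S" and r: "r = (g, y)"
      by (auto simp: S'_def)
    note move = legal_move_lexicographic_product_fst[OF c']
    show "\<not> (legal_move ?P ^^ k) c' r"
      using evasiveD(3)[OF S cr move] legal_walk_lexicographic_product_fst
      by (metis prod.collapse r)
    obtain g' where "legal_move G g g'" "(fst c', g') \<in> S"
      using evasiveD(4)[OF S cr move] by blast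
    then show "\<exists>r'. legal_move ?P r r' \<and> (c', r') \<in> S'"
      using y legal_move_verts(2)[OF c'] unfolding r
      by (intro exI[of _ "(g', y)"])
         (cases c', auto simp: S'_def legal_move_lexicographic_product_iff legal_move_def[of G])
  qed
  then show ?thesis by blast
qed

text \<open>A cop in \<open>G\<close> is simulated by one in the product that keeps its second
  coordinate, and the robber's answers are projected back.\<close>

lemma evasive_if_evasive_lexicographic_product:
  assumes G: "\<And>g. g \<in> pverts G \<Longrightarrow> \<exists>g'. (g, g') \<in> parcs G"
    and wf: "pair_graph G" and H: "pverts H \<noteq> {}"
    and S: "evasive (lexicographic_product G H) k S" and k: "k \<ge> 1"
  shows "\<exists>S'. evasive G k S'"
proof -
  interpret pair_graph G by fact
  let ?P = "lexicographic_product G H"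
  obtain y where y: "y \<in> pverts H" using H by blast
  have near: "(legal_move ?P ^^ k) p q" if "legal_move ?P p q" for p q
    by (rule relpowp_legal_move_stay[OF _ legal_move_verts(1)[OF that] k]) (use that in \<open>simp only: relpowp_1\<close>)
  \<comment> \<open>A vertex of a neighbouring fibre is adjacent to the whole fibre of
    \<open>g\<close>, so one cop step there brings the robber within distance 1.\<close>
  have diff: "g \<noteq> g'" if "((g, h), (g', h')) \<in> S" for g h g' h'
  proof
    note V = evasiveD(1,2)[OF S that]
    assume eq: "g = g'"
    obtain a where a: "(g, a) \<in> parcs G" "(a, g) \<in> parcs G" "a \<in> pverts G"
      using G V(1) arcs_symmetric in_arcsD2 by (metis mem_Sigma_iff pverts_lexicographic_product)
    then have "legal_move ?P (g, h) (a, h)" "legal_move ?P (a, h) (g', h')"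
      using V eq by (auto simp: legal_move_lexicographic_product_iff)
    then show False using near evasiveD(3)[OF S that] by blast
  qed
  define S' where "S' = {(g, g'). \<exists>h h'. ((g, h), (g', h')) \<in> S}"
  have "evasive G k S'"
  proof (rule evasiveI)
    fix c assume "c \<in> pverts G"
    then show "\<exists>r. (c, r) \<in> S'"
      using evasive_start[OF S, of "(c, y)"] y by (auto simp: S'_def)
  next
    fix c r assume "(c, r) \<in> S'"
    then show "c \<in> pverts G \<and> r \<in> pverts G"
      using evasiveD(1,2)[OF S] by (fastforce simp: S'_def)
  next
    fix c r c' assume "(c, r) \<in> S'" and c': "legal_move G c c'"
    then obtain h h' where cr: "((c, h), (r, h')) \<in> S"
      by (auto simp: S'_def)
    note V = evasiveD(1,2)[OF S cr]
    have move: "legal_move ?P (c, h) (c', h)"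
      using V c' by (auto simp: legal_move_lexicographic_product_iff legal_move_def[of G] legal_move_def[of H])
    \<comment> \<open>Otherwise \<open>c\<close> and \<open>r\<close> are adjacent in
      \<open>G\<close>, hence so are \<open>(c, h)\<close> and \<open>(r, h')\<close>, and staying
      put already captures.\<close>
    have "c' \<noteq> r"
    proof
      assume "c' = r"
      then have "legal_move ?P (c, h) (r, h')"
        using V c' diff[OF cr] by (auto simp: legal_move_lexicographic_product_iff legal_move_def[of G] legal_move_def[of H])
      then show False
        using near evasiveD(3)[OF S cr legal_move_refl] V(1) by blast
    qed
    then show "\<not> (legal_move G ^^ k) c' r"
      using evasiveD(3)[OF S cr move] legal_walk_lexicographic_productI V by fastforce
    show "\<exists>r'. legal_move G r r' \<and> (c', r') \<in> S'"
      using evasiveD(4)[OF S cr move] legal_move_lexicographic_product_fst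
      by (fastforce simp: S'_def)
  qed
  then show ?thesis by blast
qed

text \<open>
  The robber always answers inside the cop's current fibre: when the cop changes the fibre, the
  robber follows and restarts the game on \<open>H\<close>.
\<close>
lemma evasive_0_lexicographic_product_if_evasive_snd:
  assumes "pair_graph G" and S: "evasive H 0 S"
  shows "\<exists>S'. evasive (lexicographic_product G H) 0 S'"
proof -
  let ?P = "lexicographic_product G H"
  interpret G: pair_graph G by fact
  define S' where "S' = {((g, h), (g, h')) | g h h'. g \<in> pverts G \<and> (h, h') \<in> S}"
  have "evasive ?P 0 S'"
  proof (rule evasiveI)
    fix c assume "c \<in> pverts ?P"
    then show "\<exists>r. (c, r) \<in> S'"
      using evasive_start[OF S] by (force simp: S'_def)
  next
    fix c r assume "(c, r) \<in> S'"
    then show "c \<in> pverts ?P \<and> r \<in> pverts ?P"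
      using evasiveD(1,2)[OF S] by (auto simp: S'_def)
  next
    fix c r c' assume "(c, r) \<in> S'" and c': "legal_move ?P c c'"
    then obtain g h h' where eq: "c = (g, h)" "r = (g, h')" and g: "g \<in> pverts G"
      and cr: "(h, h') \<in> S"
      by (auto simp: S'_def)
    obtain g2 h2 where c'_eq: "c' = (g2, h2)" by fastforce
    note V = evasiveD(1,2)[OF S cr]
    have V2: "g2 \<in> pverts G" "h2 \<in> pverts H"
      using legal_move_verts(2)[OF c'] by (auto simp: c'_eq)
    \<comment> \<open>As \<open>G\<close> has no loops, a cop move onto \<open>r\<close> stays in
      the fibre of \<open>g\<close> and is a legal move of \<open>H\<close>.\<close>
    show "\<not> (legal_move ?P ^^ 0) c' r"
      using evasiveD(3)[OF S cr, of h2] c' G.no_loops' unfolding eq c'_eq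
      by (auto simp: legal_move_lexicographic_product_iff legal_move_def[of G] legal_move_def[of H])
    show "\<exists>r'. legal_move ?P r r' \<and> (c', r') \<in> S'"
    proof (cases "(g, g2) \<in> parcs G")
      case True
      obtain x where x: "(h2, x) \<in> S" using evasive_start[OF S V2(2)] by blast
      then have "legal_move ?P r (g2, x)"
        using True g V V2 evasiveD(2)[OF S x] by (simp add: eq legal_move_lexicographic_product_iff)
      then show ?thesis using x V2 by (auto simp: S'_def c'_eq)
    next
      case False
      then have g2: "g2 = g" and "legal_move H h h2"
        using c' by (auto simp: eq c'_eq legal_move_lexicographic_product_iff legal_move_def[of G] legal_move_def[of H])
      then obtain x where x: "legal_move H h' x" "(h2, x) \<in> S"
        using evasiveD(4)[OF S cr] by blast
      then have "legal_move ?P r (g, x)"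
        using g by (auto simp: eq legal_move_lexicographic_product_iff legal_move_def[of G] legal_move_def[of H])
      then show ?thesis using x g by (auto simp: S'_def c'_eq g2)
    qed
  qed
  then show ?thesis by blast
qed

text \<open>
  In a fibre, the cop waits at a vertex from which no robber in that fibre can evade; a robber
  leaving the fibre is caught at once, so the game inside a fibre is the game on \<open>H\<close>.
\<close>
lemma evasive_0_lexicographic_product_imp:
  assumes S: "evasive (lexicographic_product G H) 0 S"
  shows "(\<exists>S'. evasive G 0 S') \<or> (\<exists>S'. evasive H 0 S')"
proof (rule disjCI)
  let ?P = "lexicographic_product G H"
  assume noH: "\<nexists>S'. evasive H 0 S'"
  \<comment> \<open>At radius 0 the cop, being to move, captures a robber at distance at most
    1.\<close>
  have caught: "\<not> legal_move ?P p q" if "(p, q) \<in> S" for p q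
    using evasiveD(3)[OF S that, of q] by auto
  have fibre: "\<exists>h \<in> pverts H. \<forall>h'. ((g, h), (g, h')) \<notin> S" if g: "g \<in> pverts G" for g
  proof (rule ccontr)
    assume none: "\<not> ?thesis"
    define T where "T = {(h, h'). ((g, h), (g, h')) \<in> S}"
    have "evasive H 0 T"
    proof (rule evasiveI)
      fix c assume "c \<in> pverts H"
      then show "\<exists>r. (c, r) \<in> T" using none by (auto simp: T_def)
    next
      fix c r assume "(c, r) \<in> T"
      then show "c \<in> pverts H \<and> r \<in> pverts H"
        using evasiveD(1,2)[OF S] by (fastforce simp: T_def)
    next
      fix c r c' assume "(c, r) \<in> T" and c': "legal_move H c c'"
      then have cr: "((g, c), (g, r)) \<in> S" by (simp add: T_def)
      have move: "legal_move ?P (g, c) (g, c')"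
        using g c' by (auto simp: legal_move_lexicographic_product_iff legal_move_def[of G] legal_move_def[of H])
      show "\<not> (legal_move H ^^ 0) c' r"
        using evasiveD(3)[OF S cr move] by auto
      obtain x h2 where r': "legal_move ?P (g, r) (x, h2)" "((g, c'), (x, h2)) \<in> S"
        using evasiveD(4)[OF S cr move] by fastforce
      \<comment> \<open>Leaving the fibre would use an arc of \<open>G\<close>, along which the cop
        at \<open>(g, c')\<close> could move onto the robber.\<close>
      have "x = g"
        using r'(1) caught[OF r'(2)] legal_move_verts(2)[OF c']
        by (auto simp: legal_move_lexicographic_product_iff)
      then show "\<exists>r'. legal_move H r r' \<and> (c', r') \<in> T"
        using r' caught[OF r'(2)] legal_move_verts(2)[OF c']
        by (auto simp: T_def legal_move_lexicographic_product_iff legal_move_def[of G] legal_move_def[of H])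
    qed
    with noH show False by blast
  qed
  then obtain w where w: "\<And>g. g \<in> pverts G \<Longrightarrow> w g \<in> pverts H"
      "\<And>g h'. g \<in> pverts G \<Longrightarrow> ((g, w g), (g, h')) \<notin> S"
    by metis
  \<comment> \<open>Only positions with the cop at the waiting vertex \<open>w g\<close> are kept,
    which forces the robber into another fibre.\<close>
  define S' where "S' = {(g, g'). \<exists>h'. ((g, w g), (g', h')) \<in> S}"
  have "evasive G 0 S'"
  proof (rule evasiveI)
    fix c assume "c \<in> pverts G"
    then show "\<exists>r. (c, r) \<in> S'"
      using evasive_start[OF S, of "(c, w c)"] w(1) by (auto simp: S'_def)
  next
    fix c r assume "(c, r) \<in> S'"
    then show "c \<in> pverts G \<and> r \<in> pverts G"
      using evasiveD(1,2)[OF S] by (fastforce simp: S'_def)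
  next
    fix c r c' assume "(c, r) \<in> S'" and c': "legal_move G c c'"
    then obtain h' where cr: "((c, w c), (r, h')) \<in> S"
      by (auto simp: S'_def)
    note V = evasiveD(1,2)[OF S cr]
    have "c \<noteq> r" using w(2) cr V by auto
    then show "\<not> (legal_move G ^^ 0) c' r"
      using caught[OF cr] V c' by (auto simp: legal_move_lexicographic_product_iff legal_move_def[of G] legal_move_def[of H])
    \<comment> \<open>If \<open>c' \<noteq> c\<close>, the arc of \<open>G\<close> permits the
      switch to \<open>w c'\<close>; if \<open>c' = c\<close>, the cop stays put.\<close>
    have move: "legal_move ?P (c, w c) (c', w c')"
      using V c' w(1) by (auto simp: legal_move_lexicographic_product_iff legal_move_def[of G] legal_move_def[of H])
    show "\<exists>r'. legal_move G r r' \<and> (c', r') \<in> S'"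
      using evasiveD(4)[OF S cr move] legal_move_lexicographic_product_fst
      by (fastforce simp: S'_def)
  qed
  then show "\<exists>S'. evasive G 0 S'" by blast
qed

section \<open>From evasive sets to the values of \<open>rc\<close>\<close>

theorem theorem5p11:
  fixes G :: "'a pair_pre_digraph" and H :: "'b pair_pre_digraph"
  assumes "pair_graph G" and "connected (with_proj G)" and "card (pverts G) \<ge> 2"
    and "pair_graph H" and "connected (with_proj H)" and "card (pverts H) \<ge> 2"
  shows "(rc G \<ge> 1 \<longrightarrow> rc (lexicographic_product G H) = rc G) \<and>
         (rc G = 0 \<longrightarrow> rc (lexicographic_product G H) = min 1 (rc H))"
proof -
  let ?P = "lexicographic_product G H"
  have H: "pverts H \<noteq> {}" using assms(6) by auto
  note P = pair_graph_lexicographic_product[OF assms(1,4)]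
  note iff = CWRC_iff_not_evasive[OF assms(1)] CWRC_iff_not_evasive[OF assms(4)]
    CWRC_iff_not_evasive[OF P]
  have pos: "?P \<in> CWRC k \<longleftrightarrow> G \<in> CWRC k" if "k \<ge> 1" for k
    using evasive_lexicographic_product_if_evasive[OF _ H]
      evasive_if_evasive_lexicographic_product[OF connected_imp_neighbour[OF assms(1-3)] assms(1) H _ that]
    unfolding iff by blast
  have zero: "?P \<in> CWRC 0 \<longleftrightarrow> G \<in> CWRC 0 \<and> H \<in> CWRC 0"
    using evasive_lexicographic_product_if_evasive[OF _ H] evasive_0_lexicographic_product_imp
      evasive_0_lexicographic_product_if_evasive_snd[OF assms(1)]
    unfolding iff by blast
  show ?thesis
  proof (intro conjI impI)
    assume "rc G \<ge> 1"
    then have "G \<notin> CWRC 0" using rc_eq_0_iff[OF assms(1,2)] by simp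
    \<comment> \<open>At \<open>k = 0\<close> both sides are false; for other radii this is
      \<open>pos\<close>.\<close>
    then have "?P \<in> CWRC k \<longleftrightarrow> G \<in> CWRC k" for k
      using pos zero by (cases "k = 0") auto
    then show "rc ?P = rc G" unfolding rc_def by simp
  next
    assume "rc G = 0"
    then have G0: "G \<in> CWRC 0" using rc_eq_0_iff[OF assms(1,2)] by simp
    then have P1: "?P \<in> CWRC 1" using pos CWRC_mono[OF assms(1)] by auto
    show "rc ?P = min 1 (rc H)"
    proof (cases "H \<in> CWRC 0")
      case True
      then have "rc ?P = 0" using zero G0 unfolding rc_def by simp
      then show ?thesis using True rc_eq_0_iff[OF assms(4,5)] by simp
    next
      case False
      \<comment> \<open>Radius 1 wins by \<open>P1\<close>; radius 0 fails by \<open>zero\<close>,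
        since the cop already loses on \<open>H\<close>.\<close>
      have "rc ?P = 1"
        unfolding rc_def using P1 False zero
        by (intro Least_equality) (auto simp: Suc_le_eq intro!: gr0I)
      moreover have "rc H \<noteq> 0" using False rc_eq_0_iff[OF assms(4,5)] by simp
      ultimately show ?thesis by simp
    qed
  qed
qed

end
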